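(* Let $d>2$ and $n\ge1$ be fixed, and let $(\mathcal Z,\mathcal C)$ be a random Xavier initialization of the depth-$d$ ReLU network with $H$ hidden units per layer (Gaussian weights $\mathcal Z=\{\vec Z_1,\dots,\vec Z_d\}$, zero biases). Let $\mathcal D$ be a distribution on $\mathbb R^n\times[0,1]$ and $\mathcal L:\mathbb R\times\mathbb R\to[0,1]$ a loss function. With high probability over the draw of the initialization, both of the following hold. 1. The untrained network has generalization error $\tilde{\mathcal O}(1/\sqrt m)$ independent of $H$: with high probability over $m$ i.i.d. samples $(\vec x_1,y_1),\dots,(\vec x_m,y_m)$ from $\mathcal D$ (drawn independently of the initialization), $$\mathbb E_{(\vec x,y)\sim\mathcal D}\big[\mathcal L(f_{(\mathcal Z,\mathcal C)}(\vec x),y)\big]-\frac1m\sum_{i=1}^m\mathcal L(f_{(\mathcal Z,\mathcal C)}(\vec x_i),y_i)=\tilde{\mathcal O}\left(\frac1{\sqrt m}\right),$$ with the bound not depending on $H$. 2. The $\ell_2$ norm of the initialization satisfies $\displaystyle\prod_{k=1}^d\|\vec Z_k\|_F^2=\tilde\Omega(H^{d-2})$ (as $H\to\infty$).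
   Context: Network: $f_{(\mathcal W,\mathcal B)}(\vec x)=\vec W_d\,\phi\big(\vec W_{d-1}\phi(\cdots\phi(\vec W_1\vec x+\vec b_1)\cdots)+\vec b_{d-1}\big)+\vec b_d$ for $\vec x\in\mathbb R^n$, with $\phi(u)=\max(u,0)$ applied entrywise; $\vec W_1\in\mathbb R^{H\times n}$, $\vec W_k\in\mathbb R^{H\times H}$ for $1<k<d$, $\vec W_d\in\mathbb R^{1\times H}$, $\vec b_k\in\mathbb R^H$ for $k<d$, $\vec b_d\in\mathbb R$. Xavier initialization: $(\mathcal Z,\mathcal C)$ has the same shapes as $(\mathcal W,\mathcal B)$; all entries of the matrices $\vec Z_k$ are independent centered Gaussians with standard deviation $\Theta(1/\sqrt H)$ (between $a_1/\sqrt H$ and $a_2/\sqrt H$ for fixed constants $0<a_1\le a_2$, with a common value within each layer), and all biases in $\mathcal C$ are $0$. $\|\cdot\|_F$ is the Frobenius norm. "With high probability" means with probability at least $1-\delta$ for any given $\delta\in(0,1)$; in part 1, $\tilde{\mathcal O}$ hides constants and factors polylogarithmic in $m,1/\delta$; in part 2, $\tilde\Omega$ hides constants and factors polylogarithmic in $H,1/\delta$, and the bound is for all sufficiently large $H$ (depending on $d,n,\delta,a_1,a_2$), with $d,n,a_1,a_2$ fixed. *)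

theory Defs
  imports "HOL-Probability.Probability"
begin

definition relu :: "real \<Rightarrow> real" where
  "relu u = max u 0"

text \<open>
  The number of rows and columns of the weight matrix of layer \<open>k\<close> in the network of
  depth \<open>d\<close> with input dimension \<open>n\<close>, hidden width \<open>H\<close> and scalar output.  As \<open>H\<close> varies
  inside the statement, vectors and matrices are indexed by natural numbers starting
  from 0, and only the entries below these bounds matter.
\<close>

definition layer_rows :: "nat \<Rightarrow> nat \<Rightarrow> nat \<Rightarrow> nat" where
  "layer_rows d H k = (if k = d then 1 else H)"

definition layer_cols :: "nat \<Rightarrow> nat \<Rightarrow> nat \<Rightarrow> nat" where
  "layer_cols n H k = (if k = 1 then n else H)"

definition weight_index :: "nat \<Rightarrow> nat \<Rightarrow> nat \<Rightarrow> (nat \<times> nat \<times> nat) set" where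
  "weight_index d n H = {(k, i, j). k \<in> {1..d} \<and> i < layer_rows d H k \<and> j < layer_cols n H k}"

text \<open>
  \<open>W (k, i, j)\<close> is the \<open>(i, j)\<close> entry of the \<open>k\<close>-th weight matrix and \<open>B k i\<close> the \<open>i\<close>-th
  entry of the \<open>k\<close>-th bias, for \<open>1 \<le> k \<le> d\<close>.
\<close>

type_synonym weights = "nat \<times> nat \<times> nat \<Rightarrow> real"
type_synonym biases = "nat \<Rightarrow> nat \<Rightarrow> real"

definition affine_layer ::
  "nat \<Rightarrow> nat \<Rightarrow> weights \<Rightarrow> biases \<Rightarrow> nat \<Rightarrow> (nat \<Rightarrow> real) \<Rightarrow> nat \<Rightarrow> real" where
  "affine_layer n H W B k v i = (\<Sum>j<layer_cols n H k. W (k, i, j) * v j) + B k i"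

primrec hidden ::
  "nat \<Rightarrow> nat \<Rightarrow> weights \<Rightarrow> biases \<Rightarrow> (nat \<Rightarrow> real) \<Rightarrow> nat \<Rightarrow> nat \<Rightarrow> real" where
  "hidden n H W B x 0 = x"
| "hidden n H W B x (Suc k) =
     (\<lambda>i. relu (affine_layer n H W B (Suc k) (hidden n H W B x k) i))"

text \<open>No activation is applied after the last layer, whose matrix has a single row.\<close>

definition network ::
  "nat \<Rightarrow> nat \<Rightarrow> nat \<Rightarrow> weights \<Rightarrow> biases \<Rightarrow> (nat \<Rightarrow> real) \<Rightarrow> real" where
  "network d n H W B x = affine_layer n H W B d (hidden n H W B x (d - 1)) 0"

definition zero_biases :: biases where
  "zero_biases = (\<lambda>k i. 0)"

text \<open>
  The joint law of the weights: independent centered Gaussians, with standard deviation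
  \<open>\<sigma> k\<close> throughout layer \<open>k\<close>.
\<close>

definition gaussian_init :: "nat \<Rightarrow> nat \<Rightarrow> nat \<Rightarrow> (nat \<Rightarrow> real) \<Rightarrow> weights measure" where
  "gaussian_init d n H \<sigma> =
     (\<Pi>\<^sub>M (k, i, j) \<in> weight_index d n H. density lborel (\<lambda>t. ennreal (normal_density 0 (\<sigma> k) t)))"

definition frobenius_norm :: "nat \<Rightarrow> nat \<Rightarrow> (nat \<Rightarrow> nat \<Rightarrow> real) \<Rightarrow> real" where
  "frobenius_norm r c A = sqrt (\<Sum>i<r. \<Sum>j<c. (A i j)\<^sup>2)"

text \<open>An element of \<open>\<real>\<^sup>n\<close> is a function on \<open>{..<n}\<close>, labels lie in \<open>[0, 1]\<close>.\<close>

definition example_space :: "nat \<Rightarrow> ((nat \<Rightarrow> real) \<times> real) measure" where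
  "example_space n = (\<Pi>\<^sub>M i \<in> {..<n}. borel) \<Otimes>\<^sub>M restrict_space borel {0..1}"

definition risk ::
  "((nat \<Rightarrow> real) \<times> real) measure \<Rightarrow> (real \<Rightarrow> real \<Rightarrow> real) \<Rightarrow> ((nat \<Rightarrow> real) \<Rightarrow> real) \<Rightarrow> real" where
  "risk D \<L> f = (LINT (x, y)|D. \<L> (f x) y)"

definition empirical_risk ::
  "nat \<Rightarrow> (nat \<Rightarrow> (nat \<Rightarrow> real) \<times> real) \<Rightarrow> (real \<Rightarrow> real \<Rightarrow> real) \<Rightarrow>
   ((nat \<Rightarrow> real) \<Rightarrow> real) \<Rightarrow> real" where
  "empirical_risk m S \<L> f = (\<Sum>i<m. case S i of (x, y) \<Rightarrow> \<L> (f x) y) / real m"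

text \<open>
  The polylogarithmic factors hidden by the soft asymptotic notation, used for
  \<open>s, t \<ge> 1\<close>.  The summands 1 keep the factors at least 1 when the logarithms are small.
\<close>

definition polylog :: "nat \<Rightarrow> real \<Rightarrow> real \<Rightarrow> real" where
  "polylog p s t = ((1 + ln s) * (1 + ln t)) ^ p"

end

theory Submission imports Defs begin

text \<open>
  Part 1 holds for every fixed initialization: the untrained network does not depend on the
  sample, so its empirical risk is an average of i.i.d. variables in \<open>[0, 1]\<close>, and Hoeffding's
  inequality gives \<open>C = p = 1\<close>.  For part 2, \<open>\<parallel>Z\<^sub>k\<parallel>\<^sup>2 / (\<sigma> k)\<^sup>2\<close> is a chi-square variable
  with at least \<open>H\<close> degrees of freedom (\<open>H\<^sup>2\<close> for the \<open>d - 2\<close> middle layers).  A Chernoff bound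
  shows that it exceeds a quarter of its mean except with probability exponentially small in \<open>H\<close>,
  and a union bound over the layers concludes.
\<close>

section \<open>The lower tail of a chi-square variable\<close>

text \<open>The exponents add up to \<open>- 3 * t\<^sup>2 / (2 * s\<^sup>2)\<close>, so the tilt
  turns variance \<open>s\<^sup>2\<close> into a third of it; the normalizing constants differ by
  the factor \<open>sqrt 3\<close>.\<close>

lemma normal_density_times_exp_minus_square:
  assumes "s > 0"
  shows "normal_density 0 s t * exp (- (t / s)\<^sup>2) = normal_density 0 (s / sqrt 3) t / sqrt 3"
proof -
  have "- (t\<^sup>2 / (2 * s\<^sup>2)) - t\<^sup>2 / s\<^sup>2 = - (t\<^sup>2 / (2 * (s / sqrt 3)\<^sup>2))"
    using assms by (simp add: power_divide field_simps)
  then have "exp (- (t\<^sup>2 / (2 * s\<^sup>2))) * exp (- (t / s)\<^sup>2) = exp (- (t\<^sup>2 / (2 * (s / sqrt 3)\<^sup>2)))"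
    by (simp add: power_divide flip: exp_add)
  moreover have "sqrt (2 * pi * (s / sqrt 3)\<^sup>2) * sqrt 3 = sqrt (2 * pi * s\<^sup>2)"
    by (simp add: power_divide flip: real_sqrt_mult)
  ultimately show ?thesis
    by (simp add: normal_density_def divide_simps)
qed

text \<open>This is the Laplace transform \<open>1 / sqrt (1 + 2 * r)\<close> of a chi-square
  variable with one degree of freedom at \<open>r = 1\<close>. After the tilt, only the total mass 1
  of the narrower Gaussian is needed.\<close>

lemma nn_integral_normal_exp_minus_square:
  assumes "s > 0"
  shows "(\<integral>\<^sup>+ t. ennreal (exp (- (t / s)\<^sup>2)) \<partial>density lborel (\<lambda>t. ennreal (normal_density 0 s t)))
          = ennreal (1 / sqrt 3)"
proof -
  interpret prob_space "density lborel (\<lambda>t. ennreal (normal_density 0 (s / sqrt 3) t))"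
    using assms by (intro prob_space_normal_density) simp
  have total: "(\<integral>\<^sup>+ t. ennreal (normal_density 0 (s / sqrt 3) t) \<partial>lborel) = 1"
    using emeasure_space_1 by (simp add: emeasure_density)
  have "(\<integral>\<^sup>+ t. ennreal (exp (- (t / s)\<^sup>2)) \<partial>density lborel (\<lambda>t. ennreal (normal_density 0 s t)))
      = (\<integral>\<^sup>+ t. ennreal (normal_density 0 s t) * ennreal (exp (- (t / s)\<^sup>2)) \<partial>lborel)"
    by (rule nn_integral_density) measurable
  also have "\<dots> = (\<integral>\<^sup>+ t. ennreal (1 / sqrt 3) * ennreal (normal_density 0 (s / sqrt 3) t) \<partial>lborel)"
    using normal_density_times_exp_minus_square[OF assms]
    by (intro nn_integral_cong) (simp flip: ennreal_mult)
  also have "\<dots> = ennreal (1 / sqrt 3)"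
    by (subst nn_integral_cmult) (simp_all add: total)
  finally show ?thesis .
qed

text \<open>The Chernoff factor per degree of freedom: \<open>exp (1 / 4)\<close> comes from the
  threshold of a quarter of the mean, \<open>1 / sqrt 3\<close> from the Laplace transform at
  1.\<close>

definition chi_square_rate :: real where
  "chi_square_rate = exp (1 / 4) / sqrt 3"

lemma chi_square_rate_bounds: "0 \<le> chi_square_rate" "chi_square_rate < 1"
proof -
  have "exp (1 / 4 :: real) \<le> 1 + 1 / 4 + (1 / 4)\<^sup>2"
    \<comment> \<open>The bound is 1.3125, whose square is about 1.72 and thus below 3.\<close>
    by (rule exp_bound) auto
  also have "\<dots> < sqrt 3"
    by (rule real_less_rsqrt) (simp add: power2_eq_square)
  finally show "chi_square_rate < 1"
    by (simp add: chi_square_rate_def)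
qed (simp add: chi_square_rate_def)

text \<open>Chernoff's bound with parameter 1; independence turns the Laplace transform of the sum
  into a power of \<open>1 / sqrt 3\<close>. Allowing a subset \<open>J\<close> of the coordinates
  makes the bound applicable to one layer under the joint law of all weights.\<close>

lemma normal_sum_squares_lower_tail:
  fixes s :: "'i \<Rightarrow> real"
  assumes "finite I" "J \<subseteq> I" and s: "\<And>i. i \<in> I \<Longrightarrow> s i > 0"
  shows "\<P>(Z in (\<Pi>\<^sub>M i\<in>I. density lborel (\<lambda>t. ennreal (normal_density 0 (s i) t))).
           (\<Sum>i\<in>J. (Z i / s i)\<^sup>2) \<le> real (card J) / 4) \<le> chi_square_rate ^ card J"
proof -
  \<comment> \<open>Outside \<open>I\<close> the deviation is set to 1, because
    \<open>product_prob_space\<close> asks for a probability measure at every index while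
    \<open>s\<close> is known to be positive on \<open>I\<close> only.\<close>
  define N where "N = (\<lambda>i. density lborel (\<lambda>t. ennreal (normal_density 0 (if i \<in> I then s i else 1) t)))"
  have law_eq: "(\<Pi>\<^sub>M i\<in>I. density lborel (\<lambda>t. ennreal (normal_density 0 (s i) t))) = PiM I N"
    by (intro PiM_cong) (simp_all add: N_def)
  have prob: "prob_space (N i)" for i
    using s by (auto simp: N_def intro!: prob_space_normal_density)
  interpret product_prob_space N I
    by (intro product_prob_spaceI prob)
  interpret P: prob_space "PiM I N"
    by (intro prob_space_PiM prob)
  have sets_N [measurable_cong]: "sets (N i) = sets borel" for i
    by (simp add: N_def)
  define f where "f = (\<lambda>Z :: 'i \<Rightarrow> real. \<Sum>i\<in>J. (Z i / s i)\<^sup>2)"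
  have [measurable]: "(\<lambda>Z. Z i) \<in> borel_measurable (PiM I N)" if "i \<in> J" for i
    using measurable_component_singleton[of i I N] that \<open>J \<subseteq> I\<close>
    by (auto simp: measurable_cong_sets[OF refl sets_N])
  have [measurable]: "f \<in> borel_measurable (PiM I N)"
    unfolding f_def by measurable
  have "finite J"
    using assms finite_subset by blast
  \<comment> \<open>The factor 1 outside \<open>J\<close> extends the product to all of
    \<open>I\<close>, as the product integral formula requires; these coordinates integrate to
    1.\<close>
  let ?g = "\<lambda>i t. ennreal (if i \<in> J then exp (- (t / s i)\<^sup>2) else 1)"
  have g_eq: "ennreal (exp (- 1 * f Z)) = (\<Prod>i\<in>I. ?g i (Z i))" for Z
  proof -
    have "(\<Prod>i\<in>I. ?g i (Z i)) = (\<Prod>i\<in>J. ?g i (Z i))"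
      using assms by (intro prod.mono_neutral_right) auto
    also have "\<dots> = ennreal (exp (- 1 * f Z))"
      using \<open>finite J\<close> by (simp add: f_def prod_ennreal exp_sum flip: sum_negf)
    finally show ?thesis ..
  qed
  have g_int: "integral\<^sup>N (N i) (?g i) = (if i \<in> J then ennreal (1 / sqrt 3) else 1)" if "i \<in> I" for i
  proof (cases "i \<in> J")
    case True
    then show ?thesis
      using that nn_integral_normal_exp_minus_square[OF s[OF that]] by (simp add: N_def)
  next
    case False
    then show ?thesis
      using prob_space.emeasure_space_1[OF prob[of i]] by simp
  qed
  have "emeasure (PiM I N) {Z \<in> space (PiM I N). f Z \<le> real (card J) / 4}
      \<le> ennreal (exp (1 * (real (card J) / 4)))
        * (\<integral>\<^sup>+ Z. ennreal (exp (- 1 * f Z)) * indicator (space (PiM I N)) Z \<partial>PiM I N)"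
    by (rule Chernoff_ineq_nn_integral_le) auto
  also have "(\<integral>\<^sup>+ Z. ennreal (exp (- 1 * f Z)) * indicator (space (PiM I N)) Z \<partial>PiM I N)
      = (\<integral>\<^sup>+ Z. (\<Prod>i\<in>I. ?g i (Z i)) \<partial>PiM I N)"
    by (intro nn_integral_cong) (simp only: g_eq indicator_simps mult_1_right)
  also have "\<dots> = (\<Prod>i\<in>I. integral\<^sup>N (N i) (?g i))"
  proof (intro product_nn_integral_prod \<open>finite I\<close>)
    show "?g i \<in> borel_measurable (N i)" for i
      by (cases "i \<in> J") (simp_all add: measurable_cong_sets[OF sets_N refl])
  qed
  also have "\<dots> = (\<Prod>i\<in>I. if i \<in> J then ennreal (1 / sqrt 3) else 1)"
    by (intro prod.cong refl g_int)
  also have "\<dots> = (\<Prod>i\<in>J. ennreal (1 / sqrt 3))"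
    using assms by (intro prod.mono_neutral_cong_right) auto
  also have "\<dots> = ennreal ((1 / sqrt 3) ^ card J)"
    by (simp add: ennreal_power)
  also have "ennreal (exp (1 * (real (card J) / 4))) * ennreal ((1 / sqrt 3) ^ card J)
      = ennreal (chi_square_rate ^ card J)"
    by (simp add: chi_square_rate_def power_divide exp_of_nat_mult[symmetric] flip: ennreal_mult)
  finally have "P.prob {Z \<in> space (PiM I N). f Z \<le> real (card J) / 4} \<le> chi_square_rate ^ card J"
    using chi_square_rate_bounds(1) by (simp add: P.emeasure_eq_measure)
  then show ?thesis
    by (simp only: law_eq f_def)
qed

section \<open>Generalization of a function chosen independently of the sample\<close>

text \<open>Since \<open>g\<close> is fixed before the sample is drawn, the values
  \<open>g (S i)\<close> are i.i.d. in [0, 1], and the two-sided Hoeffding inequality applies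
  without any uniform bound over a class of functions.\<close>

lemma Hoeffding_product_sample:
  fixes g :: "'a \<Rightarrow> real"
  assumes "prob_space D" and g: "g \<in> borel_measurable D"
    and bounds: "\<And>z. 0 \<le> g z \<and> g z \<le> 1" and "m \<ge> 1" "\<epsilon> \<ge> 0"
  shows "\<P>(S in (\<Pi>\<^sub>M i\<in>{..<m}. D). \<bar>(\<Sum>i<m. g (S i)) / real m - (LINT z|D. g z)\<bar> \<ge> \<epsilon>)
          \<le> 2 * exp (- 2 * real m * \<epsilon>\<^sup>2)"
proof -
  interpret D: prob_space D by fact
  let ?P = "\<Pi>\<^sub>M i\<in>{..<m}. D"
  interpret P: prob_space ?P
    by (intro prob_space_PiM D.prob_space_axioms)
  note g [measurable]
  have comp: "(\<lambda>S. S i) \<in> measurable ?P D" if "i < m" for i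
    by (rule measurable_component_singleton) (use that in simp)
  have distr_comp: "distr ?P D (\<lambda>S. S i) = D" if "i < m" for i
    using distr_PiM_component[of "{..<m}" "\<lambda>_. D" i] that D.prob_space_axioms by simp
  have distr_g: "distr ?P borel (\<lambda>S. g (S i)) = distr D borel g" if "i < m" for i
    using distr_distr[OF g comp[OF that]] distr_comp[OF that] by (simp add: comp_def)
  \<comment> \<open>Independence of the coordinates amounts to their joint law being the product of
    their marginals. The joint map is the identity on the extensional functions forming the space,
    and each marginal is \<open>D\<close>.\<close>
  have "P.indep_vars (\<lambda>_. D) (\<lambda>i S. S i) {..<m}"
  proof (subst P.indep_vars_iff_distr_eq_PiM')
    have "distr ?P ?P (\<lambda>S. \<lambda>i\<in>{..<m}. S i) = distr ?P ?P (\<lambda>S. S)"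
      by (intro distr_cong) (auto simp: space_PiM PiE_def extensional_restrict)
    also have "\<dots> = ?P"
      by simp
    also have "\<dots> = (\<Pi>\<^sub>M i\<in>{..<m}. distr ?P D (\<lambda>S. S i))"
      by (intro PiM_cong) (simp_all add: distr_comp)
    finally show "distr ?P ?P (\<lambda>S. \<lambda>i\<in>{..<m}. S i) = (\<Pi>\<^sub>M i\<in>{..<m}. distr ?P D (\<lambda>S. S i))" .
  qed (use \<open>m \<ge> 1\<close> comp in \<open>auto simp: lessThan_empty_iff\<close>)
  then have indep: "P.indep_vars (\<lambda>_. borel) (\<lambda>i S. g (S i)) {..<m}"
    by (rule P.indep_vars_compose2) (use g in auto)
  have m0: "0 < m"
    using \<open>m \<ge> 1\<close> by simp
  have Y: "(\<lambda>S. g (S 0)) \<in> borel_measurable ?P"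
    using measurable_compose[OF comp[OF m0] g] .
  have expectation: "(LINT S|?P. g (S 0)) = (LINT z|D. g z)"
    using integral_distr[OF comp[OF m0] g] distr_comp[OF m0] by simp
  \<comment> \<open>Coordinate 0 exists because \<open>m \<ge> 1\<close>; it represents the common
    law of the summands.\<close>
  interpret H: Hoeffding_ineq_iid ?P "{..<m}" "\<lambda>i S. g (S i)" "\<lambda>S. g (S 0)" 0 1
      "LINT S|?P. g (S 0)"
    by unfold_locales (use indep Y bounds distr_g m0 in auto)
  show ?thesis
    using H.Hoeffding_ineq_abs_ge'[OF \<open>\<epsilon> \<ge> 0\<close>] m0 by (simp add: expectation lessThan_empty_iff)
qed

lemma network_measurable [measurable]:
  assumes "d \<ge> 2"
  shows "network d n H W B \<in> borel_measurable (\<Pi>\<^sub>M i\<in>{..<n}. borel)"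
proof -
  \<comment> \<open>The induction starts after the first layer: an input coordinate is known to be
    measurable only below \<open>n\<close>, whereas the first affine layer reads just those
    coordinates and so is measurable at every output index.\<close>
  have hidden: "(\<lambda>x. hidden n H W B x (Suc k) i) \<in> borel_measurable (\<Pi>\<^sub>M i\<in>{..<n}. borel)" for k i
  proof (induction k arbitrary: i)
    case 0
    have [measurable]: "(\<lambda>x. x j) \<in> borel_measurable (\<Pi>\<^sub>M i\<in>{..<n}. borel)" if "j < n" for j
      by (rule measurable_component_singleton) (use that in simp)
    show ?case
      by (simp add: relu_def affine_layer_def layer_cols_def)
  next
    case (Suc k)
    note Suc [measurable]
    show ?case
      by (subst hidden.simps(2)) (unfold relu_def affine_layer_def, measurable)
  qed
  have "d - 1 = Suc (d - 2)"
    using assms by simp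
  then show ?thesis
    unfolding network_def affine_layer_def using hidden[of "d - 2", measurable]
    by (simp del: hidden.simps)
qed

text \<open>The square root cancels \<open>m\<close>, leaving
  \<open>2 * exp (- 2 * L\<^sup>2)\<close> for the logarithmic factor \<open>L\<close>. From
  \<open>L \<ge> 1 + ln (1 / \<delta>) \<ge> 1\<close> follows
  \<open>L\<^sup>2 \<ge> 1 - ln \<delta>\<close>; the summand 1 yields a factor
  \<open>exp (- 1) \<le> 1 / 2\<close>, which absorbs the 2 in front.\<close>

lemma two_exp_polylog_le:
  assumes "m \<ge> 1" "0 < \<delta>" "\<delta> < 1"
  shows "2 * exp (- 2 * real m * (polylog 1 (real m) (1 / \<delta>) / sqrt (real m))\<^sup>2) \<le> \<delta>"
proof -
  define L where "L = polylog 1 (real m) (1 / \<delta>)"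
  have "ln (1 / \<delta>) \<ge> 0" "ln (real m) \<ge> 0"
    using assms by auto
  then have "(1 + 0) * (1 + ln (1 / \<delta>)) \<le> L"
    unfolding L_def polylog_def power_one_right by (intro mult_right_mono) auto
  then have L: "1 + ln (1 / \<delta>) \<le> L" "1 \<le> L"
    using \<open>ln (1 / \<delta>) \<ge> 0\<close> by auto
  then have "L * 1 \<le> L\<^sup>2"
    unfolding power2_eq_square by (intro mult_left_mono) auto
  moreover have "ln (1 / \<delta>) = - ln \<delta>"
    using assms by (simp add: ln_div)
  ultimately have "- 2 * L\<^sup>2 \<le> - 1 + ln \<delta>"
    using L by linarith
  then have "exp (- 2 * L\<^sup>2) \<le> exp (- 1) * \<delta>"
    using assms by (metis exp_add exp_le_cancel_iff exp_ln)
  also have "\<dots> \<le> (1 / 2) * \<delta>"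
    using exp_ge_add_one_self[of 1] assms by (intro mult_right_mono) (auto simp: exp_minus divide_simps)
  finally have "2 * exp (- 2 * L\<^sup>2) \<le> \<delta>"
    by simp
  moreover have "real m * (L / sqrt (real m))\<^sup>2 = L\<^sup>2"
    using assms by (simp add: power_divide)
  ultimately show ?thesis
    by (simp add: L_def mult.assoc)
qed

text \<open>Hoeffding's inequality sees the network only through a loss bounded in [0, 1], which is
  why neither the width nor the weights enter the bound. As \<open>W\<close> and \<open>B\<close>
  are arbitrary, it later holds for every outcome of the initialization.\<close>

lemma network_generalization:
  assumes "prob_space D" and D: "sets D = sets (example_space n)"
    and [measurable]: "(\<lambda>(u, y). \<L> u y) \<in> borel_measurable (borel \<Otimes>\<^sub>M borel)"
    and bounds: "\<And>u y. 0 \<le> \<L> u y \<and> \<L> u y \<le> 1"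
    and "d \<ge> 2" "m \<ge> 1" "0 < \<delta>" "\<delta> < 1"
  shows "\<P>(S in (\<Pi>\<^sub>M i\<in>{..<m}. D).
           \<bar>risk D \<L> (network d n H W B) - empirical_risk m S \<L> (network d n H W B)\<bar>
             \<le> polylog 1 (real m) (1 / \<delta>) / sqrt (real m)) \<ge> 1 - \<delta>"
proof -
  interpret D: prob_space D by fact
  let ?P = "\<Pi>\<^sub>M i\<in>{..<m}. D"
  interpret P: prob_space ?P
    by (intro prob_space_PiM D.prob_space_axioms)
  define g where "g = (\<lambda>(x, y). \<L> (network d n H W B x) y)"
  define \<epsilon> where "\<epsilon> = polylog 1 (real m) (1 / \<delta>) / sqrt (real m)"
  have "g \<in> borel_measurable (example_space n)"
  proof -
    \<comment> \<open>Labels carry the sigma-algebra of the subspace [0, 1], while the loss is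
      measurable over the whole line; the inclusion map bridges the two.\<close>
    have "snd \<in> borel_measurable (example_space n)"
      unfolding example_space_def
      by (rule measurable_compose[OF measurable_snd]) (simp add: measurable_restrict_space1)
    moreover have "(\<lambda>z. network d n H W B (fst z)) \<in> borel_measurable (example_space n)"
      unfolding example_space_def
      by (rule measurable_compose[OF measurable_fst]) (use \<open>d \<ge> 2\<close> in measurable)
    ultimately have "(\<lambda>z. (network d n H W B (fst z), snd z)) \<in> measurable (example_space n) (borel \<Otimes>\<^sub>M borel)"
      by (rule measurable_Pair[rotated])
    then have "(\<lambda>z. (\<lambda>(u, y). \<L> u y) (network d n H W B (fst z), snd z)) \<in> borel_measurable (example_space n)"
      by (rule measurable_compose) measurable
    then show ?thesis
      by (simp add: g_def case_prod_beta)
  qed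
  then have g [measurable]: "g \<in> borel_measurable D"
    by (simp add: measurable_cong_sets[OF D refl])
  have risk_eq: "risk D \<L> (network d n H W B) = (LINT z|D. g z)"
    by (simp add: risk_def g_def)
  have empirical_eq: "empirical_risk m S \<L> (network d n H W B) = (\<Sum>i<m. g (S i)) / real m" for S
    by (simp add: empirical_risk_def g_def)
  have "\<epsilon> \<ge> 0"
    using assms by (simp add: \<epsilon>_def polylog_def)
  \<comment> \<open>Deviations equal to \<open>\<epsilon>\<close> belong to both sets, so the
    complement of the first is merely contained in the second.\<close>
  let ?bad = "{S \<in> space ?P. \<bar>(\<Sum>i<m. g (S i)) / real m - (LINT z|D. g z)\<bar> \<ge> \<epsilon>}"
  let ?good = "{S \<in> space ?P. \<bar>(LINT z|D. g z) - (\<Sum>i<m. g (S i)) / real m\<bar> \<le> \<epsilon>}"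
  have [measurable]: "(\<lambda>S. g (S i)) \<in> borel_measurable ?P" if "i < m" for i
    by (rule measurable_compose[OF _ g], rule measurable_component_singleton) (use that in simp)
  have sets: "?bad \<in> P.events" "?good \<in> P.events"
    by measurable
  have "P.prob ?bad \<le> 2 * exp (- 2 * real m * \<epsilon>\<^sup>2)"
    using bounds by (intro Hoeffding_product_sample D.prob_space_axioms g \<open>m \<ge> 1\<close> \<open>\<epsilon> \<ge> 0\<close>)
      (auto simp: g_def split: prod.split)
  also have "\<dots> \<le> \<delta>"
    unfolding \<epsilon>_def by (rule two_exp_polylog_le) fact+
  finally have "P.prob ?bad \<le> \<delta>" .
  moreover have "1 - P.prob ?bad = P.prob (space ?P - ?bad)"
    using sets by (simp add: P.prob_compl)
  moreover have "P.prob (space ?P - ?bad) \<le> P.prob ?good"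
    using sets by (intro P.finite_measure_mono) (auto simp: abs_minus_commute)
  ultimately show ?thesis
    unfolding risk_eq empirical_eq \<epsilon>_def by simp
qed

section \<open>Frobenius norms of the initialization\<close>

definition layer_index :: "nat \<Rightarrow> nat \<Rightarrow> nat \<Rightarrow> nat \<Rightarrow> (nat \<times> nat \<times> nat) set" where
  "layer_index d n H k = {k} \<times> {..<layer_rows d H k} \<times> {..<layer_cols n H k}"

lemma card_layer_index: "card (layer_index d n H k) = layer_rows d H k * layer_cols n H k"
  by (simp add: layer_index_def)

lemma weight_index_eq: "weight_index d n H = (\<Union>k\<in>{1..d}. layer_index d n H k)"
  by (auto simp: weight_index_def layer_index_def)

lemma finite_weight_index: "finite (weight_index d n H)"
  by (simp add: weight_index_eq layer_index_def)

text \<open>Flattening the double sum brings the norm into the form of the chi-square bound, with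
  the layer as the subset \<open>J\<close> of all weight indices.\<close>

lemma frobenius_norm_layer:
  "(frobenius_norm (layer_rows d H k) (layer_cols n H k) (\<lambda>i j. Z (k, i, j)))\<^sup>2
     = (\<Sum>i\<in>layer_index d n H k. (Z i)\<^sup>2)"
proof -
  have "(\<Sum>i\<in>layer_index d n H k. (Z i)\<^sup>2)
      = (\<Sum>(i, j)\<in>{..<layer_rows d H k} \<times> {..<layer_cols n H k}. (Z (k, i, j))\<^sup>2)"
    unfolding layer_index_def
    by (rule sum.reindex_bij_witness[where i = "\<lambda>(i, j). (k, i, j)" and j = snd]) auto
  also have "\<dots> = (frobenius_norm (layer_rows d H k) (layer_cols n H k) (\<lambda>i j. Z (k, i, j)))\<^sup>2"
    unfolding frobenius_norm_def
    by (subst real_sqrt_pow2) (auto intro!: sum_nonneg simp: sum.cartesian_product)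
  finally show ?thesis ..
qed

lemma gaussian_init_eq:
  "gaussian_init d n H \<sigma> = (\<Pi>\<^sub>M i\<in>weight_index d n H. density lborel (\<lambda>t. ennreal (normal_density 0 (\<sigma> (fst i)) t)))"
  unfolding gaussian_init_def by (intro PiM_cong) (auto split: prod.split)

lemma gaussian_init_component_measurable:
  assumes "i \<in> weight_index d n H"
  shows "(\<lambda>Z. Z i) \<in> borel_measurable (gaussian_init d n H \<sigma>)"
proof -
  have "(\<lambda>Z. Z i) \<in> measurable (gaussian_init d n H \<sigma>)
      (density lborel (\<lambda>t. ennreal (normal_density 0 (\<sigma> (fst i)) t)))"
    unfolding gaussian_init_eq by (rule measurable_component_singleton[OF assms])
  then show ?thesis
    by simp
qed

text \<open>The deterministic half of part 2: a layer with at least \<open>H * h k\<close> entries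
  of variance at least \<open>a\<^sup>2 / H\<close> has squared norm at least
  \<open>a\<^sup>2 / 4 * h k\<close> once its normalized sum of squares exceeds a quarter of its
  mean.\<close>

lemma frobenius_prod_lower_bound:
  assumes "d > 2" "n \<ge> 1" "a > 0" "H \<ge> 1"
    and \<sigma>: "\<And>k. k \<in> {1..d} \<Longrightarrow> a / sqrt (real H) \<le> \<sigma> k"
    and Z: "\<And>k. k \<in> {1..d} \<Longrightarrow>
      real (card (layer_index d n H k)) / 4 < (\<Sum>i\<in>layer_index d n H k. (Z i / \<sigma> (fst i))\<^sup>2)"
  shows "(a\<^sup>2 / 4) ^ d * real H ^ (d - 2)
    \<le> (\<Prod>k=1..d. (frobenius_norm (layer_rows d H k) (layer_cols n H k) (\<lambda>i j. Z (k, i, j)))\<^sup>2)"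
proof -
  \<comment> \<open>A lower bound for the number of entries divided by \<open>H\<close>: the first
    layer has \<open>H * n\<close> entries, the last \<open>H\<close>, and the others
    \<open>H * H\<close>.\<close>
  define h where "h = (\<lambda>k. if k = 1 \<or> k = d then 1 else real H)"
  have layer: "0 \<le> a\<^sup>2 / 4 * h k \<and> a\<^sup>2 / 4 * h k
      \<le> (frobenius_norm (layer_rows d H k) (layer_cols n H k) (\<lambda>i j. Z (k, i, j)))\<^sup>2"
    if k: "k \<in> {1..d}" for k
  proof -
    have "a / sqrt (real H) > 0"
      using assms by simp
    with \<sigma>[OF k] have \<sigma>_pos: "\<sigma> k > 0" and "(a / sqrt (real H))\<^sup>2 \<le> (\<sigma> k)\<^sup>2"
      by (auto intro: power_mono)
    then have var: "a\<^sup>2 / real H \<le> (\<sigma> k)\<^sup>2"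
      by (simp add: power_divide)
    have "real H * 1 \<le> real H * real n"
      using assms by (intro mult_left_mono) auto
    then have size: "real H * h k \<le> real (card (layer_index d n H k))"
      using \<open>d > 2\<close> by (auto simp: h_def card_layer_index layer_rows_def layer_cols_def)
    have "a\<^sup>2 / 4 * h k = (a\<^sup>2 / real H) * (real H * h k / 4)"
      using assms by simp
    also have "\<dots> \<le> (\<sigma> k)\<^sup>2 * (real (card (layer_index d n H k)) / 4)"
      using var size by (intro mult_mono) (auto simp: h_def)
    also have "\<dots> \<le> (\<sigma> k)\<^sup>2 * (\<Sum>i\<in>layer_index d n H k. (Z i / \<sigma> (fst i))\<^sup>2)"
      using Z[OF k] by (intro mult_left_mono) auto
    also have "\<dots> = (\<Sum>i\<in>layer_index d n H k. (Z i)\<^sup>2)"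
      using \<sigma>_pos unfolding sum_distrib_left
      by (intro sum.cong) (auto simp: layer_index_def power_divide)
    finally show ?thesis
      by (simp add: frobenius_norm_layer h_def)
  qed
  \<comment> \<open>Exactly the \<open>d - 2\<close> layers strictly between the first and the last
    contribute a factor \<open>H\<close>.\<close>
  have "(\<Prod>k=1..d. h k) = (\<Prod>k\<in>{2..<d}. real H)"
    by (intro prod.mono_neutral_cong_right) (auto simp: h_def)
  then have "(a\<^sup>2 / 4) ^ d * real H ^ (d - 2) = (\<Prod>k=1..d. a\<^sup>2 / 4 * h k)"
    by (simp add: prod.distrib del: times_divide_eq_left)
  also have "\<dots> \<le> (\<Prod>k=1..d. (frobenius_norm (layer_rows d H k) (layer_cols n H k) (\<lambda>i j. Z (k, i, j)))\<^sup>2)"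
    using layer by (intro prod_mono) auto
  finally show ?thesis .
qed

lemma frobenius_prod_measurable [measurable]:
  "(\<lambda>Z. \<Prod>k=1..d. (frobenius_norm (layer_rows d H k) (layer_cols n H k) (\<lambda>i j. Z (k, i, j)))\<^sup>2)
     \<in> borel_measurable (gaussian_init d n H \<sigma>)"
proof -
  have [measurable]: "(\<lambda>Z. Z i) \<in> borel_measurable (gaussian_init d n H \<sigma>)"
    if "k \<in> {1..d}" "i \<in> layer_index d n H k" for k i
    using that by (intro gaussian_init_component_measurable) (auto simp: weight_index_eq)
  show ?thesis
    unfolding frobenius_norm_layer by measurable
qed

text \<open>A union bound over the \<open>d\<close> layers. Each has at least \<open>H\<close>
  entries and the rate is below 1, so each fails with probability at most
  \<open>chi_square_rate ^ H\<close>.\<close>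

lemma frobenius_prod_high_probability:
  assumes "d > 2" "n \<ge> 1" "a > 0" "H \<ge> 1"
    and \<sigma>: "\<And>k. k \<in> {1..d} \<Longrightarrow> a / sqrt (real H) \<le> \<sigma> k"
  shows "\<P>(Z in gaussian_init d n H \<sigma>. (a\<^sup>2 / 4) ^ d * real H ^ (d - 2)
      \<le> (\<Prod>k=1..d. (frobenius_norm (layer_rows d H k) (layer_cols n H k) (\<lambda>i j. Z (k, i, j)))\<^sup>2))
    \<ge> 1 - real d * chi_square_rate ^ H"
proof -
  let ?M = "gaussian_init d n H \<sigma>"
  let ?F = "\<lambda>Z. \<Prod>k=1..d. (frobenius_norm (layer_rows d H k) (layer_cols n H k) (\<lambda>i j. Z (k, i, j)))\<^sup>2"
  have "a / sqrt (real H) > 0"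
    using assms by simp
  with \<sigma> have \<sigma>_pos: "\<sigma> k > 0" if "k \<in> {1..d}" for k
    using that by fastforce
  then have s: "\<sigma> (fst i) > 0" if "i \<in> weight_index d n H" for i
    using that by (auto simp: weight_index_def)
  interpret M: prob_space ?M
    unfolding gaussian_init_eq using s by (intro prob_space_PiM prob_space_normal_density)
  define bad where "bad = (\<lambda>k. {Z \<in> space ?M.
    (\<Sum>i\<in>layer_index d n H k. (Z i / \<sigma> (fst i))\<^sup>2) \<le> real (card (layer_index d n H k)) / 4})"
  have bad_sets: "bad k \<in> M.events" if "k \<in> {1..d}" for k
  proof -
    have [measurable]: "(\<lambda>Z. Z i) \<in> borel_measurable ?M" if "i \<in> layer_index d n H k" for i
      using that \<open>k \<in> {1..d}\<close>
      by (intro gaussian_init_component_measurable) (auto simp: weight_index_eq)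
    show ?thesis
      unfolding bad_def by measurable
  qed
  have bad_prob: "M.prob (bad k) \<le> chi_square_rate ^ H" if "k \<in> {1..d}" for k
  proof -
    have "M.prob (bad k) \<le> chi_square_rate ^ card (layer_index d n H k)"
      unfolding bad_def gaussian_init_eq using that
      by (intro normal_sum_squares_lower_tail finite_weight_index s) (auto simp: weight_index_eq)
    also have "\<dots> \<le> chi_square_rate ^ H"
      using chi_square_rate_bounds assms
      by (intro power_decreasing) (auto simp: card_layer_index layer_rows_def layer_cols_def)
    finally show ?thesis .
  qed
  have "M.prob (\<Union>k\<in>{1..d}. bad k) \<le> (\<Sum>k\<in>{1..d}. M.prob (bad k))"
    using bad_sets by (intro M.finite_measure_subadditive_finite) auto
  also have "\<dots> \<le> (\<Sum>k\<in>{1..d}. chi_square_rate ^ H)"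
    by (intro sum_mono bad_prob)
  finally have "M.prob (\<Union>k\<in>{1..d}. bad k) \<le> real d * chi_square_rate ^ H"
    by simp
  moreover have "1 - M.prob (\<Union>k\<in>{1..d}. bad k) = M.prob (space ?M - (\<Union>k\<in>{1..d}. bad k))"
    using bad_sets by (intro M.prob_compl[symmetric] sets.finite_UN) auto
  moreover have "M.prob (space ?M - (\<Union>k\<in>{1..d}. bad k))
      \<le> M.prob {Z \<in> space ?M. (a\<^sup>2 / 4) ^ d * real H ^ (d - 2) \<le> ?F Z}"
  proof (intro M.finite_measure_mono subsetI)
    fix Z
    assume "Z \<in> space ?M - (\<Union>k\<in>{1..d}. bad k)"
    then show "Z \<in> {Z \<in> space ?M. (a\<^sup>2 / 4) ^ d * real H ^ (d - 2) \<le> ?F Z}"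
      using frobenius_prod_lower_bound[where Z = Z, OF assms] by (auto simp: bad_def not_le)
  qed measurable
  ultimately show ?thesis
    by simp
qed

section \<open>Choice of the constants and combination of the two bounds\<close>

theorem proposition6p1:
  "\<exists>(C::real) > 0. \<exists>p::nat.
    \<forall>(d::nat) (n::nat) (a1::real) (a2::real).
      d > 2 \<and> n \<ge> 1 \<and> 0 < a1 \<and> a1 \<le> a2 \<longrightarrow>
      (\<exists>(c::real) > 0. \<exists>q::nat. \<forall>\<delta>::real. 0 < \<delta> \<and> \<delta> < 1 \<longrightarrow>
        (\<exists>H0::nat. \<forall>(H::nat) (\<sigma> :: nat \<Rightarrow> real)
            (D :: ((nat \<Rightarrow> real) \<times> real) measure) (\<L> :: real \<Rightarrow> real \<Rightarrow> real).
          H \<ge> 1 \<and>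
          (\<forall>k\<in>{1..d}. a1 / sqrt (real H) \<le> \<sigma> k \<and> \<sigma> k \<le> a2 / sqrt (real H)) \<and>
          prob_space D \<and> sets D = sets (example_space n) \<and>
          (\<lambda>(u, y). \<L> u y) \<in> borel_measurable (borel \<Otimes>\<^sub>M borel) \<and>
          (\<forall>u y. 0 \<le> \<L> u y \<and> \<L> u y \<le> 1) \<longrightarrow>
          \<P>(Z in gaussian_init d n H \<sigma>.
            (\<forall>(m::nat) (\<delta>'::real). m \<ge> 1 \<and> 0 < \<delta>' \<and> \<delta>' < 1 \<longrightarrow>
              \<P>(S in (\<Pi>\<^sub>M i \<in> {..<m}. D).
                 \<bar>risk D \<L> (network d n H Z zero_biases)
                   - empirical_risk m S \<L> (network d n H Z zero_biases)\<bar>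
                 \<le> C * polylog p (real m) (1 / \<delta>') / sqrt (real m)) \<ge> 1 - \<delta>') \<and>
            (H \<ge> H0 \<longrightarrow>
              (\<Prod>k=1..d. (frobenius_norm (layer_rows d H k) (layer_cols n H k) (\<lambda>i j. Z (k, i, j)))\<^sup>2)
              \<ge> c * real H ^ (d - 2) / polylog q (real H) (1 / \<delta>)))
          \<ge> 1 - \<delta>))"
\<comment> \<open>The constants \<open>C = 1\<close> and \<open>p = 1\<close> of part 1 are
  universal, fixed even before \<open>d\<close> and \<open>n\<close>.\<close>
proof (rule exI[of _ 1], rule conjI, simp, rule exI[of _ 1], intro allI impI, elim conjE)
  fix d n :: nat and a1 a2 :: real
  assume d: "d > 2" and n: "n \<ge> 1" and a1: "0 < a1"
  show "\<exists>(c::real) > 0. \<exists>q::nat. \<forall>\<delta>::real. 0 < \<delta> \<and> \<delta> < 1 \<longrightarrow>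
        (\<exists>H0::nat. \<forall>(H::nat) (\<sigma> :: nat \<Rightarrow> real)
            (D :: ((nat \<Rightarrow> real) \<times> real) measure) (\<L> :: real \<Rightarrow> real \<Rightarrow> real).
          H \<ge> 1 \<and>
          (\<forall>k\<in>{1..d}. a1 / sqrt (real H) \<le> \<sigma> k \<and> \<sigma> k \<le> a2 / sqrt (real H)) \<and>
          prob_space D \<and> sets D = sets (example_space n) \<and>
          (\<lambda>(u, y). \<L> u y) \<in> borel_measurable (borel \<Otimes>\<^sub>M borel) \<and>
          (\<forall>u y. 0 \<le> \<L> u y \<and> \<L> u y \<le> 1) \<longrightarrow>
          \<P>(Z in gaussian_init d n H \<sigma>.
            (\<forall>(m::nat) (\<delta>'::real). m \<ge> 1 \<and> 0 < \<delta>' \<and> \<delta>' < 1 \<longrightarrow>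
              \<P>(S in (\<Pi>\<^sub>M i \<in> {..<m}. D).
                 \<bar>risk D \<L> (network d n H Z zero_biases)
                   - empirical_risk m S \<L> (network d n H Z zero_biases)\<bar>
                 \<le> 1 * polylog 1 (real m) (1 / \<delta>') / sqrt (real m)) \<ge> 1 - \<delta>') \<and>
            (H \<ge> H0 \<longrightarrow>
              (\<Prod>k=1..d. (frobenius_norm (layer_rows d H k) (layer_cols n H k) (\<lambda>i j. Z (k, i, j)))\<^sup>2)
              \<ge> c * real H ^ (d - 2) / polylog q (real H) (1 / \<delta>)))
          \<ge> 1 - \<delta>)"
  \<comment> \<open>With \<open>q = 0\<close> the polylogarithmic factor is 1: the norm bound loses
    no logarithms, and \<delta> enters only through the threshold \<open>H0\<close>.\<close>
  proof (rule exI[of _ "(a1\<^sup>2 / 4) ^ d"], rule conjI, use a1 in simp, rule exI[of _ 0],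
      intro allI impI, elim conjE)
    fix \<delta> :: real
    assume \<delta>: "0 < \<delta>" "\<delta> < 1"
    \<comment> \<open>\<open>H0\<close> is where the geometrically decaying failure probability
      falls below \<delta>; it depends on \<open>d\<close> and \<delta> alone.\<close>
    have "(\<lambda>H. real d * chi_square_rate ^ H) \<longlonglongrightarrow> real d * 0"
      using chi_square_rate_bounds by (intro tendsto_mult_left LIMSEQ_power_zero) auto
    then have "eventually (\<lambda>H. real d * chi_square_rate ^ H < \<delta>) sequentially"
      using \<delta> by (intro order_tendstoD(2)) auto
    then obtain H0 where H0: "\<And>H. H \<ge> H0 \<Longrightarrow> real d * chi_square_rate ^ H < \<delta>"
      by (auto simp: eventually_sequentially)
    show "\<exists>H0::nat. \<forall>(H::nat) (\<sigma> :: nat \<Rightarrow> real)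
            (D :: ((nat \<Rightarrow> real) \<times> real) measure) (\<L> :: real \<Rightarrow> real \<Rightarrow> real).
          H \<ge> 1 \<and>
          (\<forall>k\<in>{1..d}. a1 / sqrt (real H) \<le> \<sigma> k \<and> \<sigma> k \<le> a2 / sqrt (real H)) \<and>
          prob_space D \<and> sets D = sets (example_space n) \<and>
          (\<lambda>(u, y). \<L> u y) \<in> borel_measurable (borel \<Otimes>\<^sub>M borel) \<and>
          (\<forall>u y. 0 \<le> \<L> u y \<and> \<L> u y \<le> 1) \<longrightarrow>
          \<P>(Z in gaussian_init d n H \<sigma>.
            (\<forall>(m::nat) (\<delta>'::real). m \<ge> 1 \<and> 0 < \<delta>' \<and> \<delta>' < 1 \<longrightarrow>
              \<P>(S in (\<Pi>\<^sub>M i \<in> {..<m}. D).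
                 \<bar>risk D \<L> (network d n H Z zero_biases)
                   - empirical_risk m S \<L> (network d n H Z zero_biases)\<bar>
                 \<le> 1 * polylog 1 (real m) (1 / \<delta>') / sqrt (real m)) \<ge> 1 - \<delta>') \<and>
            (H \<ge> H0 \<longrightarrow>
              (\<Prod>k=1..d. (frobenius_norm (layer_rows d H k) (layer_cols n H k) (\<lambda>i j. Z (k, i, j)))\<^sup>2)
              \<ge> (a1\<^sup>2 / 4) ^ d * real H ^ (d - 2) / polylog 0 (real H) (1 / \<delta>)))
          \<ge> 1 - \<delta>"
    proof (rule exI[of _ H0], intro allI impI, elim conjE)
      fix H :: nat and \<sigma> :: "nat \<Rightarrow> real" and D :: "((nat \<Rightarrow> real) \<times> real) measure"
        and \<L> :: "real \<Rightarrow> real \<Rightarrow> real"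
      assume H: "H \<ge> 1"
        and \<sigma>: "\<forall>k\<in>{1..d}. a1 / sqrt (real H) \<le> \<sigma> k \<and> \<sigma> k \<le> a2 / sqrt (real H)"
        and D: "prob_space D" "sets D = sets (example_space n)"
        and L: "(\<lambda>(u, y). \<L> u y) \<in> borel_measurable (borel \<Otimes>\<^sub>M borel)"
          "\<forall>u y. 0 \<le> \<L> u y \<and> \<L> u y \<le> 1"
      let ?M = "gaussian_init d n H \<sigma>"
      let ?F = "\<lambda>Z. \<Prod>k=1..d. (frobenius_norm (layer_rows d H k) (layer_cols n H k) (\<lambda>i j. Z (k, i, j)))\<^sup>2"
      have generalization: "\<P>(S in (\<Pi>\<^sub>M i \<in> {..<m}. D).
                 \<bar>risk D \<L> (network d n H Z zero_biases)
                   - empirical_risk m S \<L> (network d n H Z zero_biases)\<bar>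
                 \<le> 1 * polylog 1 (real m) (1 / \<delta>') / sqrt (real m)) \<ge> 1 - \<delta>'"
        if "m \<ge> 1 \<and> 0 < \<delta>' \<and> \<delta>' < 1" for Z m \<delta>'
        using network_generalization[OF D L(1)] L(2) d that by simp
      have norm: "\<P>(Z in ?M. H \<ge> H0 \<longrightarrow>
          ?F Z \<ge> (a1\<^sup>2 / 4) ^ d * real H ^ (d - 2) / polylog 0 (real H) (1 / \<delta>)) \<ge> 1 - \<delta>"
      proof (cases "H \<ge> H0")
        case True
        have "1 - \<delta> \<le> 1 - real d * chi_square_rate ^ H"
          using H0[OF True] by simp
        also have "\<dots> \<le> \<P>(Z in ?M. (a1\<^sup>2 / 4) ^ d * real H ^ (d - 2) \<le> ?F Z)"
          using \<sigma> by (intro frobenius_prod_high_probability d n a1 H) auto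
        finally show ?thesis
          using True by (simp add: polylog_def)
      next
        \<comment> \<open>Below the threshold the event is the whole space, so only the total mass 1
          of the initialization law matters.\<close>
        case False
        have "0 < a1 / sqrt (real H)"
          using a1 H by simp
        then have "prob_space ?M"
          using \<sigma> unfolding gaussian_init_eq
          by (intro prob_space_PiM prob_space_normal_density) (force simp: weight_index_def)
        then show ?thesis
          using False \<delta> by (simp add: prob_space.prob_space)
      qed
      show "\<P>(Z in ?M.
            (\<forall>(m::nat) (\<delta>'::real). m \<ge> 1 \<and> 0 < \<delta>' \<and> \<delta>' < 1 \<longrightarrow>
              \<P>(S in (\<Pi>\<^sub>M i \<in> {..<m}. D).
                 \<bar>risk D \<L> (network d n H Z zero_biases)
                   - empirical_risk m S \<L> (network d n H Z zero_biases)\<bar>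
                 \<le> 1 * polylog 1 (real m) (1 / \<delta>') / sqrt (real m)) \<ge> 1 - \<delta>') \<and>
            (H \<ge> H0 \<longrightarrow> ?F Z \<ge> (a1\<^sup>2 / 4) ^ d * real H ^ (d - 2) / polylog 0 (real H) (1 / \<delta>)))
          \<ge> 1 - \<delta>"
        \<comment> \<open>The generalization conjunct is true for every \<open>Z\<close>, so the
          joint event coincides with the norm event and no probability is lost in combining
          them.\<close>
        using generalization norm by presburger
    qed
  qed
qed

end
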